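(* The sequence $\{P(B_n,q)\}_{n\geqslant0}$ of Eulerian polynomials of type $B$ is strongly $q$-log-convex.
   Context: $B_n$ is the group of signed permutations of $\{1,\dots,n\}$, i.e. bijections $\pi$ of $\{\pm1,\dots,\pm n\}$ with $\pi(-i)=-\pi(i)$. With $\pi(0):=0$, the number of $B$-descents is $d_B(\pi)=|\{i\in\{0,1,\dots,n-1\}:\pi(i)>\pi(i+1)\}|$. The Eulerian polynomials of type $B$ are $P(B_n,q)=\sum_{\pi\in B_n}q^{d_B(\pi)}$, with $P(B_0,q)=1$; equivalently, as formal power series in $x$, $$\sum_{n\geqslant0}P(B_n,q)\frac{x^n}{n!}=\frac{(1-q)e^{x(1-q)}}{1-qe^{2x(1-q)}} .$$ For real polynomials $f(q),g(q)$, write $f(q)\geqslant_q g(q)$ if $f(q)-g(q)$ has only nonnegative coefficients as a polynomial in $q$. A sequence $\{f_n(q)\}_{n\geqslant0}$ of real polynomials is strongly $q$-log-convex if $f_{m-1}(q)f_{n+1}(q)\geqslant_q f_m(q)f_n(q)$ for all $n\geqslant m\geqslant 1$. *)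

theory Defs
  imports
    Complex_Main
    "HOL-Computational_Algebra.Polynomial"
    "HOL-Combinatorics.Permutations"
begin

text \<open>The group \<open>B\<^sub>n\<close>. By the definition of \<open>permutes\<close>, its elements are extended by the
  identity outside \<open>{\<plusminus>1, \<dots>, \<plusminus>n}\<close>, so that they are determined by the bijection
  of that set and the convention \<open>\<pi>(0) = 0\<close> holds automatically.\<close>

definition signed_perms :: "nat \<Rightarrow> (int \<Rightarrow> int) set" where
  "signed_perms n =
     {\<pi>. \<pi> permutes ({- int n..int n} - {0}) \<and>
         (\<forall>i\<in>{- int n..int n} - {0}. \<pi> (- i) = - \<pi> i)}"

definition B_descents :: "nat \<Rightarrow> (int \<Rightarrow> int) \<Rightarrow> nat" where
  "B_descents n \<pi> = card {i \<in> {0..int n - 1}. \<pi> i > \<pi> (i + 1)}"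

definition eulerian_poly_B :: "nat \<Rightarrow> real poly" where
  "eulerian_poly_B n = (\<Sum>\<pi>\<in>signed_perms n. monom 1 (B_descents n \<pi>))"

definition q_ge :: "real poly \<Rightarrow> real poly \<Rightarrow> bool" (infix "\<ge>\<^sub>q" 50) where
  "f \<ge>\<^sub>q g \<longleftrightarrow> (\<forall>k. coeff (f - g) k \<ge> 0)"

definition strongly_q_log_convex :: "(nat \<Rightarrow> real poly) \<Rightarrow> bool" where
  "strongly_q_log_convex f \<longleftrightarrow>
     (\<forall>m n. 1 \<le> m \<and> m \<le> n \<longrightarrow> f (m - 1) * f (n + 1) \<ge>\<^sub>q f m * f n)"

lemma signed_perm_zero: "\<pi> \<in> signed_perms n \<Longrightarrow> \<pi> 0 = 0"
  by (auto simp: signed_perms_def permutes_def)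

lemma finite_signed_perms: "finite (signed_perms n)"
  by (rule finite_subset[OF _ finite_permutations[of "{- int n..int n} - {0}"]])
     (auto simp: signed_perms_def)

lemma eulerian_poly_B_0: "eulerian_poly_B 0 = 1"
  by (simp add: eulerian_poly_B_def signed_perms_def B_descents_def)

end

theory Submission
  imports Defs
begin

text \<open>
  The polynomials \<open>P(B\<^sub>n, q)\<close> are the moments of the J-fraction with coefficients
  \<open>s\<^sub>k = (2k + 1)(1 + q)\<close> and \<open>t\<^sub>k = 4k\<^sup>2 q\<close>. In terms of matrices, they form column 0 of
  the triangular array \<open>T\<close> with \<open>T(0, k) = [k = 0]\<close> and
  \<open>T(n+1, k) = T(n, k-1) + s\<^sub>k T(n, k) + t\<^sub>k\<^sub>+\<^sub>1 T(n, k+1)\<close>.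
  Row \<open>n + 1\<close> is row \<open>n\<close> times a tridiagonal matrix. The only 2-by-2 minors of that matrix that
  contain a subtraction of nonzero terms are \<open>s\<^sub>k s\<^sub>k\<^sub>+\<^sub>1 - t\<^sub>k\<^sub>+\<^sub>1\<close>, and these have nonnegative
  coefficients here. By a Cauchy--Binet argument the 2-by-2 minors of \<open>T\<close> then have nonnegative
  coefficients as well (\<open>tridiag_array_minor_nonneg\<close>). Expanding one step of the recurrence gives
  \<open>T(m-1, 0) T(n+1, 0) - T(m, 0) T(n, 0) = t\<^sub>1 (T(m-1, 0) T(n, 1) - T(m-1, 1) T(n, 0))\<close>,
  a nonnegative multiple of such a minor, and this is the claim
  (\<open>strongly_q_log_convex_tridiag\<close>).

  It remains to see that column 0 of \<open>T\<close> consists of the Eulerian polynomials. Inserting the letter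
  \<open>n + 1\<close> or \<open>-(n + 1)\<close> into the word of a signed permutation and counting descents yields
  \<open>P(B\<^sub>n\<^sub>+\<^sub>1) = (1 + (2n + 1) q) P(B\<^sub>n) + 2q(1 - q) P(B\<^sub>n)'\<close> (\<open>eulerian_poly_B_Suc\<close>). The array
  satisfies a matching differential identity,
  \<open>(1 - q) T(n, k)' = (k - n) T(n, k) + 2(k + 1)\<^sup>2 T(n, k+1)\<close> (\<open>array_B_pderiv\<close>), which for
  \<open>k = 0\<close> turns the tridiagonal recurrence of column 0 into the one for \<open>P(B\<^sub>n)\<close>.
\<close>

section \<open>Polynomials with nonnegative coefficients\<close>

definition nonneg_poly :: "real poly \<Rightarrow> bool" where
  "nonneg_poly p \<longleftrightarrow> (\<forall>k. coeff p k \<ge> 0)"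

lemma q_ge_iff_nonneg: "f \<ge>\<^sub>q g \<longleftrightarrow> nonneg_poly (f - g)"
  by (simp add: q_ge_def nonneg_poly_def)

lemma nonneg_poly_0 [simp]: "nonneg_poly 0"
  by (simp add: nonneg_poly_def)

lemma nonneg_poly_1 [simp]: "nonneg_poly 1"
  by (simp add: nonneg_poly_def)

lemma nonneg_poly_pCons [simp]: "nonneg_poly (pCons a p) \<longleftrightarrow> a \<ge> 0 \<and> nonneg_poly p"
  by (auto simp: nonneg_poly_def coeff_pCons split: nat.splits)

lemma nonneg_poly_add: "nonneg_poly p \<Longrightarrow> nonneg_poly q \<Longrightarrow> nonneg_poly (p + q)"
  by (simp add: nonneg_poly_def)

lemma nonneg_poly_mult: "nonneg_poly p \<Longrightarrow> nonneg_poly q \<Longrightarrow> nonneg_poly (p * q)"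
  by (auto simp: nonneg_poly_def coeff_mult intro!: sum_nonneg)

section \<open>Arrays with a tridiagonal recurrence\<close>

definition tridiag_step ::
    "(nat \<Rightarrow> real poly) \<Rightarrow> (nat \<Rightarrow> real poly) \<Rightarrow> (nat \<Rightarrow> real poly) \<Rightarrow> nat \<Rightarrow> real poly" where
  "tridiag_step s t x k =
     (case k of 0 \<Rightarrow> 0 | Suc l \<Rightarrow> x l) + s k * x k + t (Suc k) * x (Suc k)"

fun tridiag_array ::
    "(nat \<Rightarrow> real poly) \<Rightarrow> (nat \<Rightarrow> real poly) \<Rightarrow> nat \<Rightarrow> nat \<Rightarrow> real poly" where
  "tridiag_array s t 0 = (\<lambda>k. if k = 0 then 1 else 0)"
| "tridiag_array s t (Suc n) = tridiag_step s t (tridiag_array s t n)"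

lemma nonneg_tridiag_array:
  assumes s: "\<And>k. nonneg_poly (s k)" and t: "\<And>k. nonneg_poly (t k)"
  shows "nonneg_poly (tridiag_array s t n k)"
proof (induction n arbitrary: k)
  case (Suc n)
  then show ?case
    by (auto simp: tridiag_step_def split: nat.split intro!: nonneg_poly_add nonneg_poly_mult s t)
qed simp

text \<open>
  A Cauchy--Binet expansion: the minor of the new rows in columns \<open>i < j\<close> is a combination of
  minors of the old rows in columns near \<open>i\<close> and \<open>j\<close>. A reversed, hence nonpositive, old minor can
  occur only for \<open>j = i + 1\<close>, where columns \<open>i + 1\<close> and \<open>i\<close> are reached with weight \<open>t\<^sub>i\<^sub>+\<^sub>1\<close>; the
  same minor in the right order has weight \<open>s\<^sub>i s\<^sub>i\<^sub>+\<^sub>1\<close>, which outweighs it.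
\<close>

lemma tridiag_step_minor_nonneg:
  assumes s: "\<And>k. nonneg_poly (s k)" and t: "\<And>k. nonneg_poly (t k)"
    and st: "\<And>k. nonneg_poly (s k * s (Suc k) - t (Suc k))"
    and minor: "\<And>i j. i \<le> j \<Longrightarrow> nonneg_poly (x i * y j - x j * y i)"
    and ij: "i \<le> j"
  shows "nonneg_poly (tridiag_step s t x i * tridiag_step s t y j
                      - tridiag_step s t x j * tridiag_step s t y i)"
proof (cases "i = j")
  case False
  then obtain l where j: "j = Suc l" and il: "i \<le> l"
    using ij by (cases j) auto
  \<comment> \<open>The entries in column \<open>i - 1\<close>; they vanish for \<open>i = 0\<close>, and so do all their minors.\<close>
  define X where "X = (case i of 0 \<Rightarrow> 0 | Suc k \<Rightarrow> x k)"
  define Y where "Y = (case i of 0 \<Rightarrow> 0 | Suc k \<Rightarrow> y k)"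
  have XY: "nonneg_poly (X * y k - x k * Y)" if "i \<le> Suc k" for k
    using that minor by (cases i) (auto simp: X_def Y_def)
  let ?M = "\<lambda>k m. x k * y m - x m * y k"
  have step: "tridiag_step s t x i = X + s i * x i + t (Suc i) * x (Suc i)"
    "tridiag_step s t y i = Y + s i * y i + t (Suc i) * y (Suc i)"
    "tridiag_step s t x j = x l + s j * x j + t (Suc j) * x (Suc j)"
    "tridiag_step s t y j = y l + s j * y j + t (Suc j) * y (Suc j)"
    by (simp_all add: tridiag_step_def X_def Y_def j)
  \<comment> \<open>The terms with a definite sign for every \<open>j > i\<close>.\<close>
  define R where "R = (X * y l - x l * Y) + s j * (X * y j - x j * Y)
      + t (Suc j) * (X * y (Suc j) - x (Suc j) * Y)
      + s i * t (Suc j) * ?M i (Suc j) + t (Suc i) * t (Suc j) * ?M (Suc i) (Suc j)"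
  have R: "nonneg_poly R"
    unfolding R_def using il j
    by (intro nonneg_poly_add nonneg_poly_mult s t XY minor) auto
  show ?thesis
  proof (cases "l = i")
    case True
    \<comment> \<open>The minor in columns \<open>i\<close> and \<open>i + 1\<close> is met twice, once with its columns reversed.\<close>
    have "tridiag_step s t x i * tridiag_step s t y j
            - tridiag_step s t x j * tridiag_step s t y i
          = R + (s i * s (Suc i) - t (Suc i)) * ?M i (Suc i)"
      unfolding step R_def by (simp add: j True algebra_simps)
    then show ?thesis
      using R by (auto intro!: nonneg_poly_add nonneg_poly_mult st minor)
  next
    case False
    have "tridiag_step s t x i * tridiag_step s t y j
            - tridiag_step s t x j * tridiag_step s t y i
          = R + (s i * ?M i l + s i * s j * ?M i j
                 + t (Suc i) * ?M (Suc i) l + t (Suc i) * s j * ?M (Suc i) j)"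
      unfolding step R_def by (simp add: algebra_simps)
    then show ?thesis
      using R False il j by (auto intro!: nonneg_poly_add nonneg_poly_mult s t minor)
  qed
qed simp

text \<open>
  The induction lowers both row indices together, so its base case compares row \<open>0 = (1, 0, 0, \<dots>)\<close>
  with an arbitrary row, where every minor is an entry of the array or zero.
\<close>

lemma tridiag_array_minor_nonneg:
  assumes s: "\<And>k. nonneg_poly (s k)" and t: "\<And>k. nonneg_poly (t k)"
    and st: "\<And>k. nonneg_poly (s k * s (Suc k) - t (Suc k))"
    and "a \<le> b" "i \<le> j"
  defines "T \<equiv> tridiag_array s t"
  shows "nonneg_poly (T a i * T b j - T a j * T b i)"
  using \<open>a \<le> b\<close> \<open>i \<le> j\<close>
proof (induction a arbitrary: b i j)
  case 0
  then show ?case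
    using nonneg_tridiag_array[OF s t] by (auto simp: T_def)
next
  case (Suc a)
  then obtain c where "b = Suc c" "a \<le> c"
    by (cases b) auto
  with Suc show ?case
    by (auto simp: T_def intro!: tridiag_step_minor_nonneg s t st)
qed

text \<open>
  The polynomials in column 0 are the moments attached to the J-fraction with coefficients
  \<open>s\<close> and \<open>t\<close>; the difference in question is one 2-by-2 minor of their Hankel matrix, in rows 0
  and 1, and equals \<open>t\<^sub>1\<close> times a minor of the array in columns 0 and 1.
\<close>

lemma strongly_q_log_convex_tridiag:
  assumes s: "\<And>k. nonneg_poly (s k)" and t: "\<And>k. nonneg_poly (t k)"
    and st: "\<And>k. nonneg_poly (s k * s (Suc k) - t (Suc k))"
  shows "strongly_q_log_convex (\<lambda>n. tridiag_array s t n 0)"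
  unfolding strongly_q_log_convex_def q_ge_iff_nonneg
proof (intro allI impI)
  fix m n :: nat
  assume mn: "1 \<le> m \<and> m \<le> n"
  then obtain l where m: "m = Suc l" and "l \<le> n"
    by (cases m) auto
  let ?T = "tridiag_array s t"
  have "?T (m - 1) 0 * ?T (n + 1) 0 - ?T m 0 * ?T n 0
        = t 1 * (?T l 0 * ?T n 1 - ?T l 1 * ?T n 0)"
    by (simp add: m tridiag_step_def algebra_simps)
  also have "nonneg_poly \<dots>"
    using \<open>l \<le> n\<close> by (intro nonneg_poly_mult t tridiag_array_minor_nonneg s st) auto
  finally show "nonneg_poly (?T (m - 1) 0 * ?T (n + 1) 0 - ?T m 0 * ?T n 0)" .
qed

section \<open>The tridiagonal array of type B\<close>

definition diag_B :: "nat \<Rightarrow> real poly" where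
  "diag_B k = of_nat (2 * k + 1) * [:1, 1:]"

definition subdiag_B :: "nat \<Rightarrow> real poly" where
  "subdiag_B k = of_nat (4 * k ^ 2) * [:0, 1:]"

abbreviation array_B :: "nat \<Rightarrow> nat \<Rightarrow> real poly" where
  "array_B \<equiv> tridiag_array diag_B subdiag_B"

text \<open>
  The identity comes from generating functions. With \<open>E = e\<close> to the power \<open>2x(1-q)\<close>, column \<open>k\<close> has the
  exponential generating function \<open>g f\<^sup>k / k!\<close>, where \<open>g\<close> is that of the Eulerian polynomials
  of type B and \<open>f = (E - 1) / (2(1 - qE))\<close>. The operator
  \<open>V = (1 - 2qx) \<partial>\<^sub>x - 2q(1-q) \<partial>\<^sub>q\<close> satisfies \<open>V g = (1 + q) g\<close> and \<open>V f = 1 + 2f\<close>. Applying it to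
  \<open>g f\<^sup>k / k!\<close> gives a second expression for \<open>T(n+1, k)\<close>, involving the \<open>q\<close>-derivative
  of \<open>T(n, k)\<close>; equating it with the tridiagonal recurrence and dividing by \<open>2q\<close> leaves the
  identity below. Once found, it is confirmed by induction on \<open>n\<close>.
\<close>

lemma array_B_pderiv:
  "[:1, -1:] * pderiv (array_B n k) =
     (of_nat k - of_nat n) * array_B n k + of_nat (2 * (k + 1) ^ 2) * array_B n (Suc k)"
proof (induction n arbitrary: k)
  case 0
  then show ?case by simp
next
  case (Suc n)
  define q :: "real poly" where "q = [:0, 1:]"
  define K N :: "real poly" where "K = of_nat k" and "N = of_nat n"
  define D where "D = (\<lambda>k. pderiv (array_B n k))"
  define T where "T = array_B n"
  have lin: "[:1, -1:] = 1 - q" "[:1, 1:] = 1 + q" "pderiv q = 1"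
    by (simp_all add: q_def one_pCons pderiv_pCons)
  \<comment> \<open>Column \<open>k - 1\<close>, zero for \<open>k = 0\<close>; the identity for it persists there, because its
    coefficient \<open>2k\<^sup>2\<close> of column \<open>k\<close> then vanishes.\<close>
  define L DL where "L = (case k of 0 \<Rightarrow> 0 | Suc l \<Rightarrow> T l)"
    and "DL = (case k of 0 \<Rightarrow> 0 | Suc l \<Rightarrow> D l)"
  have IH: "(1 - q) * D k = (K - N) * T k + 2 * (K + 1)^2 * T (Suc k)"
    using Suc[of k] by (simp add: lin D_def T_def K_def N_def algebra_simps)
  have IH1: "(1 - q) * D (Suc k) = (K + 1 - N) * T (Suc k) + 2 * (K + 2)^2 * T (Suc (Suc k))"
    using Suc[of "Suc k"]
    by (simp add: lin D_def T_def K_def N_def algebra_simps power2_eq_square)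
  have IHL: "(1 - q) * DL = (K - 1 - N) * L + 2 * K^2 * T k"
    using Suc[of "k - 1"]
    by (cases k) (simp_all add: lin D_def T_def K_def N_def L_def DL_def algebra_simps)
  have step: "array_B (Suc n) k = L + (2*K+1) * (1+q) * T k + 4 * (K+1)^2 * q * T (Suc k)"
    "array_B (Suc n) (Suc k) = T k + (2*K+3) * (1+q) * T (Suc k) + 4 * (K+2)^2 * q * T (Suc (Suc k))"
    by (simp_all add: tridiag_step_def diag_B_def subdiag_B_def lin K_def L_def T_def q_def [symmetric]
        algebra_simps split: nat.split)
  have const: "pderiv K = 0"
    by (simp add: K_def of_nat_poly pderiv_pCons)
  have "pderiv L = DL"
    by (simp add: L_def DL_def D_def T_def split: nat.split)
  then have "pderiv (array_B (Suc n) k) = DL + (2*K+1) * T k + (2*K+1) * (1+q) * D k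
      + 4 * (K+1)^2 * T (Suc k) + 4 * (K+1)^2 * q * D (Suc k)"
    unfolding step
    by (simp add: pderiv_add pderiv_mult lin const D_def T_def power2_eq_square
        algebra_simps)
  then have "(1 - q) * pderiv (array_B (Suc n) k)
     = (1 - q) * DL + (2*K+1) * (1+q) * ((1 - q) * D k)
       + 4 * (K+1)^2 * q * ((1 - q) * D (Suc k))
       + (1 - q) * ((2*K+1) * T k + 4 * (K+1)^2 * T (Suc k))"
    by (simp add: algebra_simps)
  also have "\<dots> = (K - (N + 1)) * array_B (Suc n) k + 2 * (K+1)^2 * array_B (Suc n) (Suc k)"
    unfolding IH IH1 IHL step by (simp add: power2_eq_square algebra_simps)
  finally show ?case
    by (simp add: lin K_def N_def algebra_simps)
qed

section \<open>Signed permutations as words\<close>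

fun descents :: "int list \<Rightarrow> nat" where
  "descents (x # y # zs) = (if x > y then 1 else 0) + descents (y # zs)"
| "descents _ = 0"

text \<open>
  The one-line notations \<open>\<pi>(1) \<dots> \<pi>(n)\<close> of signed permutations. No absolute value can repeat, since
  \<open>n\<close> letters have to produce \<open>n\<close> of them.
\<close>

definition signed_words :: "nat \<Rightarrow> int list set" where
  "signed_words n = {w. length w = n \<and> abs ` set w = {1..int n}}"

lemma signed_words_distinct:
  assumes "w \<in> signed_words n"
  shows "distinct (map abs w)"
proof (rule card_distinct)
  show "card (set (map abs w)) = length (map abs w)"
    using assms by (simp add: signed_words_def)
qed

lemma signed_words_nth_eq_abs:
  assumes "w \<in> signed_words n" "i < n" "j < n" "\<bar>w ! i\<bar> = \<bar>w ! j\<bar>"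
  shows "i = j"
  using assms signed_words_distinct[OF assms(1)]
  by (auto simp: signed_words_def distinct_conv_nth)

lemma descents_map_upto:
  "descents (map f [i..j]) = card {k \<in> {i..j - 1}. f k > f (k + 1)}"
proof (induction "nat (j - i)" arbitrary: i)
  case 0
  then show ?case by (cases "i = j") auto
next
  case (Suc d)
  then have ij: "i < j" by simp
  have IH: "descents (map f [i+1..j]) = card {k \<in> {i+1..j - 1}. f k > f (k + 1)}"
    by (rule Suc(1)) (use Suc(2) in simp)
  have eq: "{k \<in> {i..j - 1}. f k > f (k + 1)}
     = (if f i > f (i + 1) then {i} else {}) \<union> {k \<in> {i+1..j - 1}. f k > f (k + 1)}"
    using ij by (auto simp: order_le_less)
  have "card {k \<in> {i..j - 1}. f k > f (k + 1)}
     = (if f i > f (i + 1) then 1 else 0) + card {k \<in> {i+1..j - 1}. f k > f (k + 1)}"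
    unfolding eq
    by (subst card_Un_disjoint) (auto intro: finite_subset[of _ "{i+1..j - 1}"])
  moreover have "[i..j] = i # (i + 1) # [i + 1 + 1..j]" "[i+1..j] = (i + 1) # [i + 1 + 1..j]"
    using ij by (simp_all add: upto_rec1)
  ultimately show ?case
    using IH by simp
qed

text \<open>
  The odd extension of a word to a function on the integers. It is the identity at 0 and beyond the
  length of the word, as \<open>permutes\<close> demands.
\<close>

definition word_perm :: "int list \<Rightarrow> int \<Rightarrow> int" where
  "word_perm w i = (if i \<noteq> 0 \<and> \<bar>i\<bar> \<le> int (length w) then sgn i * w ! nat (\<bar>i\<bar> - 1) else i)"

lemma word_perm_signed_perm:
  assumes w: "w \<in> signed_words n"
  shows "word_perm w \<in> signed_perms n"
proof -
  let ?S = "{- int n..int n} - {0}"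
  have len: "length w = n"
    using w by (simp add: signed_words_def)
  have rng: "\<bar>w ! nat (\<bar>i\<bar> - 1)\<bar> \<in> {1..int n}" if "i \<in> ?S" for i
  proof -
    have "\<bar>w ! nat (\<bar>i\<bar> - 1)\<bar> \<in> abs ` set w"
      using that len by (intro imageI nth_mem) auto
    then show ?thesis
      using w by (simp add: signed_words_def)
  qed
  have into: "word_perm w ` ?S \<subseteq> ?S"
  proof safe
    fix i assume "i \<in> {- int n..int n}" "i \<noteq> 0"
    then show "word_perm w i \<in> {- int n..int n}" "word_perm w i = 0 \<Longrightarrow> False"
      using rng[of i] by (auto simp: word_perm_def len sgn_if split: if_splits)
  qed
  have "inj_on (word_perm w) ?S"
  proof (rule inj_onI)
    fix i j assume i: "i \<in> ?S" and j: "j \<in> ?S" and eq: "word_perm w i = word_perm w j"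
    from eq have eq': "sgn i * w ! nat (\<bar>i\<bar> - 1) = sgn j * w ! nat (\<bar>j\<bar> - 1)"
      using i j by (auto simp: word_perm_def len split: if_splits)
    then have "\<bar>w ! nat (\<bar>i\<bar> - 1)\<bar> = \<bar>w ! nat (\<bar>j\<bar> - 1)\<bar>"
      using i j by (auto simp: sgn_if split: if_splits)
    then have "nat (\<bar>i\<bar> - 1) = nat (\<bar>j\<bar> - 1)"
      using i j by (intro signed_words_nth_eq_abs[OF w]) auto
    then have "\<bar>i\<bar> = \<bar>j\<bar>"
      using i j by auto
    then show "i = j"
      using eq' rng[OF i] i j by (auto simp: sgn_if split: if_splits)
  qed
  then have "bij_betw (word_perm w) ?S ?S"
    using into by (simp add: bij_betw_def endo_inj_surj)
  then have "word_perm w permutes ?S"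
    by (rule bij_imp_permutes) (auto simp: word_perm_def len)
  then show ?thesis
    by (auto simp: signed_perms_def word_perm_def len sgn_if)
qed

lemma map_signed_perm_word:
  assumes "\<pi> \<in> signed_perms n"
  shows "map \<pi> [1..int n] \<in> signed_words n"
proof -
  let ?S = "{- int n..int n} - {0}"
  have perm: "\<pi> permutes ?S" and odd: "\<And>i. i \<in> ?S \<Longrightarrow> \<pi> (- i) = - \<pi> i"
    using assms by (auto simp: signed_perms_def)
  have "\<bar>\<pi> i\<bar> \<in> {1..int n}" if "i \<in> {1..int n}" for i
    using permutes_in_image[OF perm, of i] that by auto
  moreover have "k \<in> (\<lambda>i. \<bar>\<pi> i\<bar>) ` {1..int n}" if k: "k \<in> {1..int n}" for k
  proof -
    have "k \<in> \<pi> ` ?S"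
      using k by (subst permutes_image[OF perm]) auto
    then obtain i where i: "i \<in> ?S" "\<pi> i = k"
      by (metis imageE)
    then have "\<bar>\<pi> \<bar>i\<bar>\<bar> = k" "\<bar>i\<bar> \<in> {1..int n}"
      using k odd[OF i(1)] by (auto simp: abs_if)
    then show ?thesis by force
  qed
  ultimately have "(\<lambda>i. \<bar>\<pi> i\<bar>) ` {1..int n} = {1..int n}"
    by blast
  then show ?thesis
    by (simp add: signed_words_def image_image)
qed

lemma word_perm_map:
  assumes "\<pi> \<in> signed_perms n"
  shows "word_perm (map \<pi> [1..int n]) = \<pi>"
proof
  fix i
  let ?S = "{- int n..int n} - {0}"
  have perm: "\<pi> permutes ?S" and odd: "\<And>i. i \<in> ?S \<Longrightarrow> \<pi> (- i) = - \<pi> i"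
    using assms by (auto simp: signed_perms_def)
  show "word_perm (map \<pi> [1..int n]) i = \<pi> i"
  proof (cases "i \<in> ?S")
    case True
    then show ?thesis
      using odd[OF True] by (auto simp: word_perm_def sgn_if abs_if)
  next
    case False
    then show ?thesis
      using permutes_not_in[OF perm False] by (auto simp: word_perm_def)
  qed
qed

lemma map_word_perm:
  assumes "w \<in> signed_words n"
  shows "map (word_perm w) [1..int n] = w"
  using assms by (intro nth_equalityI) (auto simp: signed_words_def word_perm_def)

text \<open>The leading letter 0 accounts for the convention \<open>\<pi>(0) = 0\<close>, that is, for a descent at 0.\<close>

lemma eulerian_poly_B_words:
  "eulerian_poly_B n = (\<Sum>w\<in>signed_words n. monom 1 (descents (0 # w)))"
  unfolding eulerian_poly_B_def
proof (rule sum.reindex_bij_witness[where i = word_perm and j = "\<lambda>\<pi>. map \<pi> [1..int n]"])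
  fix \<pi> assume \<pi>: "\<pi> \<in> signed_perms n"
  have "[0..int n] = 0 # [1..int n]"
    by (simp add: upto_rec1)
  then have "map \<pi> [0..int n] = 0 # map \<pi> [1..int n]"
    using signed_perm_zero[OF \<pi>] by simp
  then have "descents (0 # map \<pi> [1..int n]) = B_descents n \<pi>"
    using descents_map_upto[of \<pi> 0 "int n"] by (simp add: B_descents_def)
  then show "monom (1::real) (descents (0 # map \<pi> [1..int n])) = monom 1 (B_descents n \<pi>)"
    by simp
qed (auto intro: word_perm_signed_perm map_signed_perm_word word_perm_map map_word_perm)

section \<open>Inserting the letter of largest absolute value\<close>

definition insert_at :: "int \<Rightarrow> nat \<Rightarrow> int list \<Rightarrow> int list" where
  "insert_at c p w = take p w @ c # drop p w"

lemma insert_at_0 [simp]: "insert_at c 0 w = c # w"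
  by (simp add: insert_at_def)

lemma insert_at_Suc [simp]: "insert_at c (Suc p) (b # w) = b # insert_at c p w"
  by (simp add: insert_at_def)

lemma sum_insert_at_Cons:
  "(\<Sum>p\<le>length (b # w). f (insert_at c p (b # w)))
     = f (c # b # w) + (\<Sum>p\<le>length w. f (b # insert_at c p w))"
  by (simp only: length_Cons sum.atMost_Suc_shift insert_at_0 insert_at_Suc)

text \<open>
  A letter larger than all others creates an ascent followed by a descent. The number \<open>d\<close> of descents
  is kept if it enters one of the \<open>d\<close> descents or goes to the end, and grows by one if it
  enters one of the ascents. For a letter smaller than all others, a descent is followed by an ascent,
  so that the final position is among those that add a descent.
\<close>

lemma sum_descents_insert_max:
  assumes "\<forall>x\<in>set (a # w). x < c"
  defines "d \<equiv> descents (a # w)"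
  shows "(\<Sum>p\<le>length w. monom (1::real) (descents (a # insert_at c p w)))
         = monom (1 + real d) d + monom (real (length w) - real d) (Suc d)"
  using assms(1) unfolding d_def
proof (induction w arbitrary: a)
  case (Cons b w)
  let ?e = "if a > b then 1 else 0 :: nat"
  have "(\<Sum>p\<le>length (b # w). monom (1::real) (descents (a # insert_at c p (b # w))))
      = monom 1 (Suc (descents (b # w)))
        + (\<Sum>p\<le>length w. monom 1 ?e * monom 1 (descents (b # insert_at c p w)))"
    using Cons.prems sum_insert_at_Cons[of "\<lambda>v. monom (1::real) (descents (a # v))" c b w]
    by (auto simp: mult_monom)
  also have "(\<Sum>p\<le>length w. monom (1::real) ?e * monom 1 (descents (b # insert_at c p w)))
      = monom 1 ?e * (monom (1 + real (descents (b # w))) (descents (b # w))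
          + monom (real (length w) - real (descents (b # w))) (Suc (descents (b # w))))"
    using Cons by (simp flip: sum_distrib_left)
  finally show ?case
    by (simp add: mult_monom algebra_simps add_monom)
qed (simp add: monom_0)

lemma sum_descents_insert_min:
  assumes "\<forall>x\<in>set (a # w). c < x"
  defines "d \<equiv> descents (a # w)"
  shows "(\<Sum>p\<le>length w. monom (1::real) (descents (a # insert_at c p w)))
         = monom (real d) d + monom (1 + real (length w) - real d) (Suc d)"
  using assms(1) unfolding d_def
proof (induction w arbitrary: a)
  case (Cons b w)
  let ?e = "if a > b then 1 else 0 :: nat"
  have "(\<Sum>p\<le>length (b # w). monom (1::real) (descents (a # insert_at c p (b # w))))
      = monom 1 (Suc (descents (b # w)))
        + (\<Sum>p\<le>length w. monom 1 ?e * monom 1 (descents (b # insert_at c p w)))"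
    using Cons.prems sum_insert_at_Cons[of "\<lambda>v. monom (1::real) (descents (a # v))" c b w]
    by (auto simp: mult_monom)
  also have "(\<Sum>p\<le>length w. monom (1::real) ?e * monom 1 (descents (b # insert_at c p w)))
      = monom 1 ?e * (monom (real (descents (b # w))) (descents (b # w))
          + monom (1 + real (length w) - real (descents (b # w))) (Suc (descents (b # w))))"
    using Cons by (simp flip: sum_distrib_left)
  finally show ?case
    by (simp add: mult_monom algebra_simps add_monom)
qed simp

lemma insert_at_signed_words:
  assumes "w \<in> signed_words n" "p \<le> n" "\<bar>c\<bar> = int (Suc n)"
  shows "insert_at c p w \<in> signed_words (Suc n)"
proof -
  have "set (insert_at c p w) = insert c (set w)"
    unfolding insert_at_def by (metis Un_insert_right append_take_drop_id list.simps(15) set_append)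
  moreover have "{1..int (Suc n)} = insert (int (Suc n)) {1..int n}"
    by auto
  ultimately show ?thesis
    using assms by (simp add: signed_words_def) (simp add: insert_at_def)
qed

text \<open>
  Deleting the letter of absolute value \<open>n + 1\<close> inverts insertion; this is the decomposition that
  makes insertion surjective.
\<close>

lemma signed_words_Suc_split:
  assumes "v \<in> signed_words (Suc n)"
  obtains us c vs where "v = us @ c # vs" "\<bar>c\<bar> = int (Suc n)" "us @ vs \<in> signed_words n"
proof -
  have len: "length v = Suc n" and absv: "abs ` set v = {1..int (Suc n)}"
    using assms by (auto simp: signed_words_def)
  then have "int (Suc n) \<in> abs ` set v"
    by simp
  then obtain c where "c \<in> set v" and c: "\<bar>c\<bar> = int (Suc n)"
    by (metis imageE)
  then obtain us vs where v: "v = us @ c # vs"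
    by (metis split_list)
  have "\<bar>c\<bar> \<notin> abs ` set (us @ vs)"
    using signed_words_distinct[OF assms] by (auto simp: v)
  moreover have "insert \<bar>c\<bar> (abs ` set (us @ vs)) = {1..int (Suc n)}"
    using absv by (auto simp: v)
  ultimately have "abs ` set (us @ vs) = {1..int (Suc n)} - {\<bar>c\<bar>}"
    by blast
  also have "\<dots> = {1..int n}"
    using c by auto
  finally have "us @ vs \<in> signed_words n"
    using len by (simp add: signed_words_def v)
  with v c show thesis by (rule that)
qed

lemma bij_betw_insert_at:
  "bij_betw (\<lambda>(w, p, c). insert_at c p w)
     (signed_words n \<times> {..n} \<times> {int (Suc n), - int (Suc n)}) (signed_words (Suc n))"
proof -
  let ?N = "int (Suc n)"
  let ?A = "signed_words n \<times> {..n} \<times> {?N, - ?N}"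
  let ?small = "\<lambda>x::int. \<bar>x\<bar> \<noteq> ?N"
  define locate where
    "locate = (\<lambda>v. let p = length (takeWhile ?small v) in (filter ?small v, p, v ! p))"
  have locate: "locate (us @ c # vs) = (us @ vs, length us, c)"
    if "us @ vs \<in> signed_words n" "\<bar>c\<bar> = ?N" for us vs c
  proof -
    have "abs ` set (us @ vs) = {1..int n}"
      using that(1) by (simp add: signed_words_def)
    then have "\<forall>x\<in>set (us @ vs). \<bar>x\<bar> \<le> int n"
      by (metis atLeastAtMost_iff imageI)
    then have small: "\<forall>x\<in>set (us @ vs). ?small x"
      by fastforce
    then have "takeWhile ?small (us @ c # vs) = us"
      using that(2) by (simp add: takeWhile_append)
    then show ?thesis
      using small that(2) by (simp add: locate_def)
  qed
  show ?thesis
  proof (rule bij_betw_byWitness[where f' = locate])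
    show "\<forall>x\<in>?A. locate (case x of (w, p, c) \<Rightarrow> insert_at c p w) = x"
    proof
      fix x assume "x \<in> ?A"
      then obtain w p c where x: "x = (w, p, c)"
        and w: "w \<in> signed_words n" and p: "p \<le> n" and c: "\<bar>c\<bar> = ?N"
        by auto
      then have "p \<le> length w"
        by (simp add: signed_words_def)
      then show "locate (case x of (w, p, c) \<Rightarrow> insert_at c p w) = x"
        using locate[of "take p w" "drop p w" c] w c by (simp add: x insert_at_def)
    qed
    show "\<forall>v\<in>signed_words (Suc n). (case locate v of (w, p, c) \<Rightarrow> insert_at c p w) = v"
    proof
      fix v assume "v \<in> signed_words (Suc n)"
      then obtain us c vs where "v = us @ c # vs" "\<bar>c\<bar> = ?N" "us @ vs \<in> signed_words n"
        by (rule signed_words_Suc_split)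
      then show "(case locate v of (w, p, c) \<Rightarrow> insert_at c p w) = v"
        by (simp add: locate insert_at_def)
    qed
    show "(\<lambda>(w, p, c). insert_at c p w) ` ?A \<subseteq> signed_words (Suc n)"
      by (auto intro!: insert_at_signed_words)
    show "locate ` signed_words (Suc n) \<subseteq> ?A"
    proof
      fix x assume "x \<in> locate ` signed_words (Suc n)"
      then obtain v where "x = locate v" "v \<in> signed_words (Suc n)"
        by blast
      moreover from this(2) obtain us c vs
        where "v = us @ c # vs" "\<bar>c\<bar> = ?N" "us @ vs \<in> signed_words n"
        by (rule signed_words_Suc_split)
      moreover from this(3) have "length us \<le> n"
        by (simp add: signed_words_def)
      ultimately show "x \<in> ?A"
        by (auto simp: locate)
    qed
  qed
qed

text \<open>
  For a word with \<open>d\<close> descents, the \<open>2(n + 1)\<close> insertions of \<open>n + 1\<close> or \<open>-(n + 1)\<close> produce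
  \<open>1 + 2d\<close> words with \<open>d\<close> descents and \<open>1 + 2(n - d)\<close> words with \<open>d + 1\<close> descents. The factor \<open>d\<close> in
  \<open>(1 + 2d) q\<^sup>d + (1 + 2n - 2d) q\<^sup>d q\<close> becomes a derivative.
\<close>

lemma eulerian_poly_B_Suc:
  "eulerian_poly_B (Suc n) =
     [:1, real (2 * n + 1):] * eulerian_poly_B n + [:0, 2, -2:] * pderiv (eulerian_poly_B n)"
proof -
  let ?N = "int (Suc n)"
  have each: "(\<Sum>p\<le>n. \<Sum>c\<in>{?N, - ?N}. monom (1::real) (descents (0 # insert_at c p w)))
      = [:1, real (2 * n + 1):] * monom 1 (descents (0 # w))
        + [:0, 2, -2:] * pderiv (monom 1 (descents (0 # w)))"
    if w: "w \<in> signed_words n" for w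
  proof -
    have len: "length w = n" and "abs ` set w = {1..int n}"
      using w by (auto simp: signed_words_def)
    then have bound: "\<forall>x\<in>set w. \<bar>x\<bar> \<le> int n"
      by force
    define d where "d = descents (0 # w)"
    have "(\<Sum>p\<le>n. \<Sum>c\<in>{?N, - ?N}. monom (1::real) (descents (0 # insert_at c p w)))
       = (\<Sum>p\<le>length w. monom (1::real) (descents (0 # insert_at ?N p w)))
         + (\<Sum>p\<le>length w. monom (1::real) (descents (0 # insert_at (- ?N) p w)))"
      by (simp add: sum.distrib len)
    also have "\<dots> = (monom (1 + real d) d + monom (real n - real d) (Suc d))
         + (monom (real d) d + monom (1 + real n - real d) (Suc d))"
      using bound
      by (subst sum_descents_insert_max, force, subst sum_descents_insert_min, force)
         (simp add: d_def len)
    also have "\<dots> = [:1, real (2 * n + 1):] * monom 1 d + [:0, 2, -2:] * pderiv (monom 1 d)"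
    proof (rule poly_eqI)
      fix k
      show "coeff (monom (1 + real d) d + monom (real n - real d) (Suc d)
               + (monom (real d) d + monom (1 + real n - real d) (Suc d))) k
          = coeff ([:1, real (2 * n + 1):] * monom 1 d + [:0, 2, -2:] * pderiv (monom 1 d)) k"
        by (cases d) (auto simp: pderiv_monom coeff_pCons split: nat.split)
    qed
    finally show ?thesis by (simp only: d_def)
  qed
  have "eulerian_poly_B (Suc n)
      = (\<Sum>(w, p, c)\<in>signed_words n \<times> {..n} \<times> {?N, - ?N}.
           monom 1 (descents (0 # insert_at c p w)))"
    unfolding eulerian_poly_B_words
    by (subst sum.reindex_bij_betw[OF bij_betw_insert_at, symmetric])
       (simp add: case_prod_unfold)
  also have "\<dots> = (\<Sum>w\<in>signed_words n. \<Sum>p\<le>n. \<Sum>c\<in>{?N, - ?N}.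
           monom 1 (descents (0 # insert_at c p w)))"
    by (simp only: sum.cartesian_product)
  also have "\<dots> = [:1, real (2 * n + 1):] * eulerian_poly_B n
      + [:0, 2, -2:] * pderiv (eulerian_poly_B n)"
    unfolding eulerian_poly_B_words
    by (simp only: each sum.distrib sum_distrib_left
        higher_pderiv_sum[of 1, simplified] cong: sum.cong)
  finally show ?thesis .
qed

section \<open>Strong q-log-convexity\<close>

lemma eulerian_poly_B_eq_array: "eulerian_poly_B n = array_B n 0"
proof (induction n)
  case 0
  then show ?case by (simp add: eulerian_poly_B_0)
next
  case (Suc n)
  define q :: "real poly" where "q = [:0, 1:]"
  have lin: "[:1, real (2 * n + 1):] = 1 + of_nat (2 * n + 1) * q"
     "[:0, 2, -2:] = 2 * q * [:1, -1:]" "[:1,1:] = 1 + q"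
    by (simp_all add: q_def one_pCons of_nat_poly numeral_poly)
  have "eulerian_poly_B (Suc n) = (1 + of_nat (2 * n + 1) * q) * array_B n 0
      + 2 * q * ([:1, -1:] * pderiv (array_B n 0))"
    by (simp only: eulerian_poly_B_Suc Suc lin mult.assoc)
  also have "\<dots> = array_B (Suc n) 0"
    unfolding array_B_pderiv
    by (simp add: tridiag_step_def diag_B_def subdiag_B_def lin q_def[symmetric] algebra_simps)
  finally show ?case .
qed

theorem proposition3p3:
  shows "strongly_q_log_convex eulerian_poly_B"
proof -
  have "strongly_q_log_convex (\<lambda>n. array_B n 0)"
  proof (rule strongly_q_log_convex_tridiag)
    fix k :: nat
    show "nonneg_poly (diag_B k)" "nonneg_poly (subdiag_B k)"
      by (simp_all add: diag_B_def subdiag_B_def of_nat_poly)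
    show "nonneg_poly (diag_B k * diag_B (Suc k) - subdiag_B (Suc k))"
      by (simp add: diag_B_def subdiag_B_def of_nat_poly algebra_simps power2_eq_square)
  qed
  then show ?thesis
    by (simp add: eulerian_poly_B_eq_array[abs_def])
qed

end
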